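(* Let $q>1$ and $m>0$ be integers with $\gcd(q,m)=1$. Let $T$ be a positive integer which is a multiple of $\nu_m(q)$, and let $l\in\{0,1,2,\ldots\}$, $n\in\{1,2,3,\ldots\}$ and $r\in\mathbb{Z}$. Then $$\sum_{k=0}^n(-1)^k\binom nk\left[\begin{matrix} kT+l\\ r\end{matrix}\right]_m\equiv\begin{cases} 2^l(1-2^T)^n/m \pmod{q^n}&\text{if } m \text{ is odd},\\ \delta_{l,0}(-1)^r/m \pmod{q^n}&\text{if } m \text{ is even},\end{cases}$$ where $\delta_{l,0}$ equals $1$ if $l=0$ and $0$ otherwise.
   Context: For $m\in\mathbb{Z}^+$, $N\in\{0,1,2,\ldots\}$ and $r\in\mathbb{Z}$, $\left[\begin{matrix} N\\ r\end{matrix}\right]_m=\sum_{0\le k\le N,\ k\equiv r \pmod m}\binom Nk$. For integers $q>1$, $m>0$ with $\gcd(q,m)=1$, write $q=\prod_{s=1}^t p_s^{\alpha_s}$ with distinct primes $p_s$ and $\alpha_s\ge1$, and let $\beta_s$ be the multiplicative order of $p_s$ modulo $m$ (the least positive integer with $p_s^{\beta_s}\equiv1\pmod m$); then $\nu_m(q)=\operatorname{lcm}[p_1^{\alpha_1-1}(p_1^{\beta_1}-1),\ldots,p_t^{\alpha_t-1}(p_t^{\beta_t}-1)]$. Since $\gcd(m,q)=1$, division by $m$ in a congruence modulo $q^n$ means multiplication by the inverse of $m$ modulo $q^n$. *)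

theory Defs
  imports "HOL-Number_Theory.Number_Theory"
begin

definition binom_residue_sum :: "nat \<Rightarrow> nat \<Rightarrow> int \<Rightarrow> nat" where
  "binom_residue_sum m N r = (\<Sum>k | k \<le> N \<and> [int k = r] (mod int m). N choose k)"

text \<open>
  The least common multiple of the numbers $p^{\alpha-1}(p^\beta-1)$, where $p$ runs over the
  primes dividing $q$, $\alpha$ is the exponent of $p$ in $q$ and $\beta$ is the multiplicative
  order of $p$ modulo $m$. It is meant for coprime $m$ and $q$; otherwise the library's
  \<^term>\<open>ord m p\<close> may be $0$.
\<close>
definition nu :: "nat \<Rightarrow> nat \<Rightarrow> nat" where
  "nu m q = (LCM p\<in>prime_factors q. p ^ (multiplicity p q - 1) * (p ^ ord m p - 1))"

end

theory Submission
  imports Defs "HOL-Computational_Algebra.Polynomial"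
begin

text \<open>
  The sum is the coefficient at $x^r$ of $(1+x)^l (1-(1+x)^T)^n$ in $\mathbb{Z}[x]/(x^m-1)$.
  Let $\epsilon = 1$ for odd $m$ and $\epsilon = -1$ for even $m$, and
  $N = \sum_{i<m} (\epsilon x)^i$, so that $(1+x) N = (1+\epsilon) N$ and $N^2 = m N$. Then
  $E = m - N$ satisfies $E^2 = m E$, and $1+x$ is invertible on the part cut out by $E$, up to a
  factor $m$. There the Frobenius congruence
  $(1+x)^{p^\beta} \equiv 1 + x^{p^\beta} = 1 + x \pmod p$ may be divided by $1+x$, which gives
  $E (1-(1+x)^T) \equiv 0 \pmod q$ and hence $E (1-(1+x)^T)^n \equiv 0 \pmod{q^n}$. Adding
  the part cut out by $N$, one gets
  $m (1+x)^l (1-(1+x)^T)^n \equiv (1+\epsilon)^l (1-(1+\epsilon)^T)^n N \pmod{q^n}$.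
\<close>

section \<open>Arithmetic modulo an ideal with two generators\<close>

text \<open>Divisibility by \<open>c\<close> in the quotient ring modulo \<open>P\<close>, expressed
  without forming that quotient.\<close>

definition ideal2 :: "'a::comm_ring_1 \<Rightarrow> 'a \<Rightarrow> 'a \<Rightarrow> bool" where
  "ideal2 P c f \<longleftrightarrow> (\<exists>u v. f = P * u + c * v)"

lemma ideal2I: "f = P * u + c * v \<Longrightarrow> ideal2 P c f"
  unfolding ideal2_def by blast

lemma ideal2_add:
  assumes "ideal2 P c f" "ideal2 P c g"
  shows "ideal2 P c (f + g)"
proof -
  obtain u v u' v' where "f = P * u + c * v" "g = P * u' + c * v'"
    using assms unfolding ideal2_def by blast
  then have "f + g = P * (u + u') + c * (v + v')" by (simp add: algebra_simps)
  then show ?thesis by (rule ideal2I)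
qed

lemma ideal2_mult_left:
  assumes "ideal2 P c f"
  shows "ideal2 P c (g * f)"
proof -
  obtain u v where "f = P * u + c * v"
    using assms unfolding ideal2_def by blast
  then have "g * f = P * (g * u) + c * (g * v)" by (simp add: algebra_simps)
  then show ?thesis by (rule ideal2I)
qed

lemma ideal2_mult_right: "ideal2 P c f \<Longrightarrow> ideal2 P c (f * g)"
  using ideal2_mult_left[of P c f g] by (simp add: mult.commute)

lemma ideal2_diff:
  assumes "ideal2 P c f" "ideal2 P c g"
  shows "ideal2 P c (f - g)"
  using ideal2_add[OF assms(1) ideal2_mult_left[OF assms(2), of "-1"]] by simp

lemma ideal2_dvd_left: "P dvd f \<Longrightarrow> ideal2 P c f"
  unfolding dvd_def ideal2_def by (metis add.right_neutral mult_zero_right)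

lemma ideal2_dvd_right: "c dvd f \<Longrightarrow> ideal2 P c f"
  unfolding dvd_def ideal2_def by (metis add.left_neutral mult_zero_right)

text \<open>Every cross term contains \<open>P\<close>, so the second generators multiply while
  \<open>P\<close> stays to the first power. Iterating this takes a modulus \<open>q\<close> to
  \<open>q ^ n\<close>.\<close>

lemma ideal2_mult:
  assumes "ideal2 P c f" "ideal2 P d g"
  shows "ideal2 P (c * d) (f * g)"
proof -
  obtain u v u' v' where "f = P * u + c * v" "g = P * u' + d * v'"
    using assms unfolding ideal2_def by blast
  then have "f * g = P * (u * g + c * v * u') + (c * d) * (v * v')" by (simp add: algebra_simps)
  then show ?thesis by (rule ideal2I)
qed

lemma ideal2_power:
  assumes "ideal2 P c f"
  shows "ideal2 P (c ^ n) (f ^ n)"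
proof (induction n)
  case 0
  then show ?case by (simp add: ideal2_dvd_right)
next
  case (Suc n)
  then show ?case using ideal2_mult[OF assms Suc] by simp
qed

lemma ideal2_mono:
  assumes "ideal2 P c f" "d dvd c"
  shows "ideal2 P d f"
proof -
  obtain u v where "f = P * u + c * v"
    using assms unfolding ideal2_def by blast
  moreover obtain k where "c = d * k" using assms by blast
  ultimately have "f = P * u + d * (k * v)" by (simp add: algebra_simps)
  then show ?thesis by (rule ideal2I)
qed

lemma of_nat_dvd_of_nat: "a dvd b \<Longrightarrow> of_nat a dvd (of_nat b :: 'a::comm_semiring_1)"
  by (auto elim!: dvdE)

lemma of_nat_bezout:
  assumes "coprime (a :: nat) b"
  obtains s t :: "'a::comm_ring_1" where "s * of_nat a + t * of_nat b = 1"
proof -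
  have "gcd (int a) (int b) = 1" using assms by (simp flip: coprime_iff_gcd_eq_1)
  then obtain u v :: int where "u * int a + v * int b = 1"
    using bezout_int[of "int a" "int b"] by metis
  then have "of_int (u * int a + v * int b) = (of_int 1 :: 'a)" by (rule arg_cong)
  then have "of_int u * of_nat a + of_int v * of_nat b = (1 :: 'a)" by simp
  then show thesis by (rule that)
qed

text \<open>A Bezout relation makes \<open>k\<close> a unit modulo \<open>c\<close>. This serves to
  cancel powers of \<open>m\<close>.\<close>

lemma ideal2_cancel:
  assumes "ideal2 P (of_nat c) (of_nat k * f)" "coprime k c"
  shows "ideal2 P (of_nat c) f"
proof -
  obtain s t :: 'a where st: "s * of_nat k + t * of_nat c = 1"
    using of_nat_bezout[OF assms(2)] .
  have "s * (of_nat k * f) + of_nat c * (t * f) = (s * of_nat k + t * of_nat c) * f"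
    by (simp add: algebra_simps)
  then have "f = s * (of_nat k * f) + of_nat c * (t * f)" by (simp add: st)
  moreover have "ideal2 P (of_nat c) (s * (of_nat k * f) + of_nat c * (t * f))"
    by (intro ideal2_add ideal2_mult_left[OF assms(1)] ideal2_dvd_right dvd_triv_left)
  ultimately show ?thesis by simp
qed

text \<open>A Bezout relation writes \<open>f\<close> as \<open>s * (a * f) + t * (b * f)\<close>;
  each of the two products gets its missing modulus from the other hypothesis.\<close>

lemma ideal2_coprime:
  assumes "ideal2 P (of_nat a) f" "ideal2 P (of_nat b) f" "coprime a b"
  shows "ideal2 P (of_nat (a * b)) f"
proof -
  obtain s t :: 'a where st: "s * of_nat a + t * of_nat b = 1"
    using of_nat_bezout[OF assms(3)] .
  have "s * (of_nat a * f) + t * (f * of_nat b) = (s * of_nat a + t * of_nat b) * f"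
    by (simp add: algebra_simps)
  then have eq: "f = s * (of_nat a * f) + t * (f * of_nat b)" by (simp add: st)
  have "ideal2 P (of_nat (a * b)) (of_nat a * f)"
    using ideal2_mult[OF ideal2_dvd_right[OF dvd_refl] assms(2)] by simp
  moreover have "ideal2 P (of_nat (a * b)) (f * of_nat b)"
    using ideal2_mult[OF assms(1) ideal2_dvd_right[OF dvd_refl]] by simp
  ultimately show ?thesis
    using ideal2_add[OF ideal2_mult_left ideal2_mult_left] eq by metis
qed

lemma ideal2_prod:
  assumes "finite S" "\<And>p. p \<in> S \<Longrightarrow> prime (p :: nat)"
    and "\<And>p. p \<in> S \<Longrightarrow> ideal2 P (of_nat (p ^ k p)) f"
  shows "ideal2 P (of_nat (\<Prod>p\<in>S. p ^ k p)) f"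
  using assms
proof (induction S rule: finite_induct)
  case empty
  then show ?case by (simp add: ideal2_dvd_right)
next
  case (insert p S)
  have "coprime (p ^ k p) (\<Prod>p\<in>S. p ^ k p)"
    using insert
    by (intro prod_coprime_right coprime_power_left_iff[THEN iffD2]
        coprime_power_right_iff[THEN iffD2] disjI1 primes_coprime) auto
  then show ?case
    using insert ideal2_coprime[of P "p ^ k p" f "\<Prod>p\<in>S. p ^ k p"] by simp
qed

section \<open>Lifting to prime powers and the Frobenius congruence\<close>

text \<open>The expansion of \<open>(1 + (y - 1)) ^ n\<close> to first order. For
  \<open>n = p\<close> its linear term gains a factor \<open>p\<close>, which drives the lifting of
  exponents.\<close>

lemma square_dvd_power_expansion:
  fixes y :: "'a::comm_ring_1"
  shows "(y - 1)\<^sup>2 dvd y ^ n - 1 - of_nat n * (y - 1)"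
proof (induction n)
  case 0
  then show ?case by simp
next
  case (Suc n)
  have "y ^ Suc n - 1 - of_nat (Suc n) * (y - 1)
      = y * (y ^ n - 1 - of_nat n * (y - 1)) + (y - 1)\<^sup>2 * of_nat n"
    by (simp add: algebra_simps power2_eq_square)
  then show ?case using Suc by simp
qed

text \<open>Each further p-th power gains one factor \<open>p\<close>. In the expansion of
  \<open>Y ^ p - 1\<close> the linear term gains it directly. For the quadratic term,
  \<open>m * (e * (Y - 1)^2)\<close> agrees modulo \<open>P\<close> with the square of
  \<open>e * (Y - 1)\<close>; the squared modulus \<open>p ^ (2 * a + 2)\<close> is a multiple of
  \<open>p ^ (a + 2)\<close>, and \<open>m\<close> cancels.\<close>

lemma ideal2_lift_exponent:
  fixes e y :: "'a::comm_ring_1"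
  assumes "P dvd e * e - of_nat m * e" "coprime m p"
    and base: "ideal2 P (of_nat p) (e * (y - 1))"
  shows "ideal2 P (of_nat (p ^ Suc a)) (e * (y ^ p ^ a - 1))"
proof (induction a)
  case 0
  then show ?case using base by simp
next
  case (Suc a)
  define Y where "Y = y ^ p ^ a"
  let ?I = "ideal2 P (of_nat (p ^ Suc (Suc a)))"
  have IH: "ideal2 P (of_nat (p ^ Suc a)) (e * (Y - 1))"
    using Suc by (simp add: Y_def)
  obtain z where z: "Y ^ p - 1 - of_nat p * (Y - 1) = (Y - 1)\<^sup>2 * z"
    using square_dvd_power_expansion by blast
  have lin: "?I (of_nat p * (e * (Y - 1)))"
    using ideal2_mult[OF ideal2_dvd_right[OF dvd_refl] IH, of "of_nat p"] by simp
  have "ideal2 P (of_nat (p ^ Suc a) * of_nat (p ^ Suc a)) (e * (Y - 1) * (e * (Y - 1)))"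
    by (rule ideal2_mult[OF IH IH])
  then have "?I (e * (Y - 1) * (e * (Y - 1)))"
  proof (rule ideal2_mono)
    have "p ^ Suc (Suc a) dvd p ^ (Suc a + Suc a)" by (rule le_imp_power_dvd) simp
    then show "of_nat (p ^ Suc (Suc a)) dvd (of_nat (p ^ Suc a) * of_nat (p ^ Suc a) :: 'a)"
      by (metis of_nat_dvd_of_nat of_nat_mult power_add)
  qed
  moreover have "?I ((e * e - of_nat m * e) * (Y - 1)\<^sup>2)"
    using assms(1) by (intro ideal2_dvd_left) simp
  ultimately have "?I (e * (Y - 1) * (e * (Y - 1)) - (e * e - of_nat m * e) * (Y - 1)\<^sup>2)"
    by (rule ideal2_diff)
  also have "e * (Y - 1) * (e * (Y - 1)) - (e * e - of_nat m * e) * (Y - 1)\<^sup>2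
      = of_nat m * (e * (Y - 1)\<^sup>2)"
    by (simp add: algebra_simps power2_eq_square)
  finally have quad: "?I (e * (Y - 1)\<^sup>2)"
    by (rule ideal2_cancel) (simp add: assms(2) coprime_power_right_iff)
  have "?I (of_nat p * (e * (Y - 1)) + e * (Y - 1)\<^sup>2 * z)"
    by (rule ideal2_add[OF lin ideal2_mult_right[OF quad]])
  also have "of_nat p * (e * (Y - 1)) + e * (Y - 1)\<^sup>2 * z = e * (Y ^ p - 1)"
    unfolding mult.assoc z[symmetric] by (simp add: algebra_simps)
  also have "Y ^ p = y ^ p ^ Suc a"
    by (simp add: Y_def flip: power_mult) (simp add: mult.commute)
  finally show ?case .
qed

text \<open>The inner binomial coefficients in a prime row are multiples of
  \<open>p\<close>.\<close>

lemma prime_dvd_add_power_diff: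
  fixes a b :: "'a::comm_ring_1"
  assumes "prime p"
  shows "of_nat p dvd (a + b) ^ p - (a ^ p + b ^ p)"
proof -
  have p: "p > 0" using assms prime_gt_0_nat by blast
  have "(a + b) ^ p = (\<Sum>k\<le>p. of_nat (p choose k) * a ^ k * b ^ (p - k))"
    by (rule binomial_ring)
  also have "{..p} = insert 0 (insert p {0<..<p})" using p by auto
  also have "(\<Sum>k\<in>\<dots>. of_nat (p choose k) * a ^ k * b ^ (p - k))
      = a ^ p + b ^ p + (\<Sum>k\<in>{0<..<p}. of_nat (p choose k) * a ^ k * b ^ (p - k))"
    using p by (simp add: algebra_simps)
  finally have "(a + b) ^ p - (a ^ p + b ^ p)
      = (\<Sum>k\<in>{0<..<p}. of_nat (p choose k) * a ^ k * b ^ (p - k))" by simp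
  moreover have "of_nat p dvd of_nat (p choose k) * a ^ k * b ^ (p - k)" if "k \<in> {0<..<p}" for k
  proof -
    have "p dvd (p choose k)" using that assms by (intro dvd_choose_prime) auto
    then show ?thesis by (simp add: of_nat_dvd_of_nat dvd_mult2)
  qed
  ultimately show ?thesis by (simp only: dvd_sum)
qed

text \<open>Iterated Frobenius: the error \<open>p * z\<close> of one stage contributes only
  multiples of \<open>p\<close> after the next p-th power.\<close>

lemma prime_dvd_one_plus_power_diff:
  fixes x :: "'a::comm_ring_1"
  assumes "prime p"
  shows "of_nat p dvd (1 + x) ^ p ^ k - (1 + x ^ p ^ k)"
proof (induction k)
  case 0
  then show ?case by simp
next
  case (Suc k)
  define Y where "Y = 1 + x ^ p ^ k"
  obtain z where z: "(1 + x) ^ p ^ k - Y = of_nat p * z"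
    using Suc unfolding Y_def by blast
  have p: "p > 0" using assms prime_gt_0_nat by blast
  have "of_nat p dvd (Y + of_nat p * z) ^ p - (Y ^ p + (of_nat p * z) ^ p)"
    "of_nat p dvd (1 + x ^ p ^ k) ^ p - (1 ^ p + (x ^ p ^ k) ^ p)"
    by (rule prime_dvd_add_power_diff[OF assms])+
  moreover have "of_nat p dvd (of_nat p * z) ^ p"
    using p by (metis dvd_power dvd_triv_left dvd_trans)
  ultimately have "of_nat p dvd ((Y + of_nat p * z) ^ p - (Y ^ p + (of_nat p * z) ^ p))
      + (of_nat p * z) ^ p + (Y ^ p - (1 + (x ^ p ^ k) ^ p))"
    unfolding Y_def by (intro dvd_add) simp_all
  moreover have "Y + of_nat p * z = (1 + x) ^ p ^ k" using z by (simp add: algebra_simps)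
  ultimately have "of_nat p dvd ((1 + x) ^ p ^ k) ^ p - (1 + (x ^ p ^ k) ^ p)"
    by (simp add: algebra_simps)
  then show ?case by (simp only: power_Suc2 power_mult)
qed

lemma minus_one_dvd_power: "(y::'a::comm_ring_1) - 1 dvd y ^ n - 1"
  by (simp add: power_diff_1_eq)

lemma power_minus_one_dvd:
  fixes y :: "'a::comm_ring_1"
  assumes "a dvd b"
  shows "y ^ a - 1 dvd y ^ b - 1"
  using assms minus_one_dvd_power[of "y ^ a"] by (auto simp: power_mult dvd_def[of a b])

section \<open>The ring with a cyclic relation\<close>

text \<open>
  \<open>x\<close> is the indeterminate rather than its class, so the relation $x^m = 1$ holds only
  modulo \<open>P\<close>.
\<close>
locale cyclic_relation =
  fixes x :: "'a::comm_ring_1" and m :: nat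
begin

definition P :: 'a where "P = x ^ m - 1"
text \<open>An m-th root of unity at which \<open>1 + x\<close> may fail to be a unit: its value
  there is 2 for odd \<open>m\<close>, which is no unit modulo an even \<open>q\<close>, and 0 for
  even \<open>m\<close>. Splitting off this root leaves a part on which \<open>1 + x\<close> can be
  inverted up to a factor \<open>m\<close>.\<close>

definition eps :: 'a where "eps = (if odd m then 1 else - 1)"
definition N :: 'a where "N = (\<Sum>i<m. (eps * x) ^ i)"
definition E :: 'a where "E = of_nat m - N"

lemma eps_x_power: "(eps * x) ^ m - 1 = P"
  by (simp add: eps_def P_def)

text \<open>The geometric sum telescopes to \<open>(eps * x) ^ m - 1\<close>, which is
  \<open>P\<close>. As \<open>eps * eps = 1\<close>, multiplication by \<open>x\<close> acts on
  \<open>N\<close> as \<open>eps\<close> modulo \<open>P\<close>.\<close>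

lemma eps_x_N: "(eps * x) * N = N + P"
proof -
  have "(eps * x - 1) * N = P"
    unfolding N_def power_diff_1_eq[symmetric] by (rule eps_x_power)
  then show ?thesis by (simp add: algebra_simps)
qed

lemma P_dvd_one_plus_x_N: "P dvd (1 + x) * N - (1 + eps) * N"
proof -
  have "(1 + x) * N - (1 + eps) * N = eps * (eps * x * N) - eps * N"
    by (simp add: eps_def algebra_simps)
  also have "\<dots> = eps * P" unfolding eps_x_N by (simp add: distrib_left)
  finally show ?thesis by simp
qed

lemma P_dvd_power_N: "P dvd (1 + x) ^ k * N - (1 + eps) ^ k * N"
proof (induction k)
  case 0
  then show ?case by simp
next
  case (Suc k)
  have "(1 + x) ^ Suc k * N - (1 + eps) ^ Suc k * N
    = (1 + x) * ((1 + x) ^ k * N - (1 + eps) ^ k * N) + (1 + eps) ^ k * ((1 + x) * N - (1 + eps) * N)"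
    by (simp add: algebra_simps)
  then show ?case using Suc P_dvd_one_plus_x_N by (simp add: dvd_add)
qed

text \<open>Each of the \<open>m\<close> powers summed in one factor \<open>N\<close> fixes the
  other factor modulo \<open>P\<close>.\<close>

lemma P_dvd_N_square: "P dvd N * N - of_nat m * N"
proof -
  have "P dvd (eps * x) ^ i * N - N" for i
  proof (induction i)
    case (Suc i)
    have "(eps * x) ^ Suc i * N - N = (eps * x) * ((eps * x) ^ i * N - N) + P"
      using eps_x_N by (simp add: algebra_simps)
    then show ?case using Suc by simp
  qed simp
  then have "P dvd (\<Sum>i<m. (eps * x) ^ i * N - N)" by (intro dvd_sum)
  also have "(\<Sum>i<m. (eps * x) ^ i * N - N) = N * N - of_nat m * N"
    unfolding N_def by (simp add: sum_subtractf sum_distrib_right)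
  finally show ?thesis .
qed

lemma P_dvd_E_square: "P dvd E * E - of_nat m * E"
proof -
  have "E * E - of_nat m * E = N * N - of_nat m * N"
    by (simp add: E_def algebra_simps)
  then show ?thesis using P_dvd_N_square by simp
qed

lemma one_plus_x_invertible:
  obtains w c where "c = 1 \<or> c = m" "P dvd (1 + x) * w * E - of_nat c * E"
proof (cases "odd m")
  case True
  then obtain h where h: "m = 2 * h + 1" by (rule oddE)
  \<comment> \<open>Multiplying the even powers up to \<open>x ^ (m - 1)\<close> by
    \<open>1 + x\<close> gives all powers up to \<open>x ^ m\<close>, that is, \<open>N + 1\<close>
    modulo \<open>P\<close>. Since \<open>N * E\<close> vanishes modulo \<open>P\<close>, this acts
    as 1 on \<open>E\<close>, so \<open>c = 1\<close>.\<close>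
  define w where "w = (\<Sum>i<Suc h. x ^ (2 * i))"
  have geo: "(1 + x) * (\<Sum>i<k. x ^ (2 * i)) = (\<Sum>i<2 * k. x ^ i)" for k
    by (induction k) (simp_all add: algebra_simps)
  have "2 * Suc h = Suc m" using h by simp
  then have "(1 + x) * w = (\<Sum>i<Suc m. x ^ i)"
    unfolding w_def geo by (rule arg_cong)
  also have "\<dots> = N + 1 + P"
    using True by (simp add: N_def eps_def P_def)
  finally have "(1 + x) * w * E - of_nat 1 * E = P * E - (N * N - of_nat m * N)"
    by (simp add: E_def algebra_simps)
  then have "P dvd (1 + x) * w * E - of_nat 1 * E"
    using P_dvd_N_square by (simp add: dvd_diff)
  then show thesis using that by blast
next
  case False
  \<comment> \<open>Subtracting \<open>N\<close> from \<open>m\<close> term by term shows that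
    \<open>E\<close> itself is \<open>(1 + x) * w\<close>; since \<open>E * E\<close> is
    \<open>m * E\<close> modulo \<open>P\<close>, this gives \<open>c = m\<close>.\<close>
  have "1 + x dvd (\<Sum>i<m. 1 - (- x) ^ i)"
  proof (rule dvd_sum)
    show "1 + x dvd 1 - (- x) ^ i" for i
      using one_diff_power_eq[of "- x" i] by simp
  qed
  also have "(\<Sum>i<m. 1 - (- x) ^ i) = E"
    using False by (simp add: E_def N_def eps_def sum_subtractf)
  finally obtain w where "E = (1 + x) * w" by blast
  then show thesis using that[of m w] P_dvd_E_square by simp
qed

lemma ideal2_E_prime:
  assumes "prime p" "coprime m p"
  shows "ideal2 P (of_nat p) (E * ((1 + x) ^ (p ^ ord m p - 1) - 1))"
proof -
  define s where "s = p ^ ord m p - 1"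
  have s: "p ^ ord m p = Suc s"
    using assms(1) prime_gt_0_nat unfolding s_def by (metis Suc_pred' power_eq_0_iff not_gr0)
  have "[Suc s = 1] (mod m)" using ord[of p m] by (simp add: s)
  then have "m dvd s" by (simp add: cong_altdef_nat)
  then have "P dvd x ^ s - 1" unfolding P_def by (rule power_minus_one_dvd)
  then have cyc: "ideal2 P (of_nat p) (x * (x ^ s - 1))"
    by (intro ideal2_dvd_left) simp
  have "of_nat p dvd (1 + x) ^ Suc s - (1 + x ^ Suc s)"
    using prime_dvd_one_plus_power_diff[OF assms(1), of x "ord m p"] by (simp add: s)
  then have "ideal2 P (of_nat p) (((1 + x) ^ Suc s - (1 + x ^ Suc s)) + x * (x ^ s - 1))"
    by (rule ideal2_add[OF ideal2_dvd_right cyc])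
  also have "((1 + x) ^ Suc s - (1 + x ^ Suc s)) + x * (x ^ s - 1) = (1 + x) * ((1 + x) ^ s - 1)"
    by (simp add: algebra_simps)
  finally have fr: "ideal2 P (of_nat p) ((1 + x) * ((1 + x) ^ s - 1))" .
  obtain w c where c: "c = 1 \<or> c = m" "P dvd (1 + x) * w * E - of_nat c * E"
    by (rule one_plus_x_invertible)
  \<comment> \<open>Multiplying by \<open>w * E\<close> trades the factor \<open>1 + x\<close> for
    \<open>c\<close>, which is coprime to \<open>p\<close> and cancels.\<close>
  have "ideal2 P (of_nat p) (w * E * ((1 + x) * ((1 + x) ^ s - 1))
      - ((1 + x) * w * E - of_nat c * E) * ((1 + x) ^ s - 1))"
    by (intro ideal2_diff ideal2_mult_left[OF fr] ideal2_mult_right ideal2_dvd_left c)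
  also have "w * E * ((1 + x) * ((1 + x) ^ s - 1))
      - ((1 + x) * w * E - of_nat c * E) * ((1 + x) ^ s - 1) = of_nat c * (E * ((1 + x) ^ s - 1))"
    by (simp add: algebra_simps)
  finally show ?thesis
    unfolding s_def using c(1) assms(2) by (elim ideal2_cancel) auto
qed

text \<open>This is where the shape of \<open>nu\<close> comes from: the exponent
  \<open>p ^ ord m p - 1\<close> already gives the modulus \<open>p\<close>, and each additional
  factor \<open>p\<close> in the exponent raises the modulus by one power. So \<open>p ^ a\<close>
  suffices for \<open>p ^ Suc a\<close>, and coprime prime powers combine to
  \<open>q\<close>.\<close>

lemma ideal2_E_nu:
  assumes "q > 0" "coprime q m" "nu m q dvd T"
  shows "ideal2 P (of_nat q) (E * ((1 + x) ^ T - 1))"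
proof -
  have "ideal2 P (of_nat (p ^ multiplicity p q)) (E * ((1 + x) ^ T - 1))"
    if p: "p \<in> prime_factors q" for p
  proof -
    define s a where "s = p ^ ord m p - 1" and "a = multiplicity p q - 1"
    have pr: "prime p" "p dvd q" using p by auto
    then have cop: "coprime m p" using coprime_divisors[OF _ dvd_refl assms(2), of p]
      by (simp add: coprime_commute)
    have mult: "multiplicity p q = Suc a"
      using p by (simp add: a_def prime_factors_multiplicity)
    have "p ^ a * s dvd nu m q"
      unfolding nu_def a_def s_def using p by (intro dvd_Lcm image_eqI[OF refl])
    then have "s * p ^ a dvd T" using assms(3) by (subst mult.commute) (rule dvd_trans)
    then have "(1 + x) ^ (s * p ^ a) - 1 dvd (1 + x) ^ T - 1"
      by (rule power_minus_one_dvd)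
    then obtain z where z: "(1 + x) ^ T - 1 = ((1 + x) ^ (s * p ^ a) - 1) * z" by blast
    have "ideal2 P (of_nat (p ^ Suc a)) (E * (((1 + x) ^ s) ^ p ^ a - 1))"
      using P_dvd_E_square cop ideal2_E_prime[OF pr(1) cop]
      unfolding s_def by (rule ideal2_lift_exponent)
    then have "ideal2 P (of_nat (p ^ Suc a)) (E * (((1 + x) ^ s) ^ p ^ a - 1) * z)"
      by (rule ideal2_mult_right)
    then show ?thesis by (simp only: mult z power_mult mult.assoc)
  qed
  then have "ideal2 P (of_nat (\<Prod>p\<in>prime_factors q. p ^ multiplicity p q)) (E * ((1 + x) ^ T - 1))"
    by (intro ideal2_prod) auto
  then show ?thesis unfolding prime_factorization_nat[OF assms(1), symmetric] .
qed

text \<open>The n-th power of the congruence for \<open>E * D\<close> contains \<open>E ^ n\<close>,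
  which is \<open>m ^ (n - 1) * E\<close> modulo \<open>P\<close>; the power of \<open>m\<close> is
  coprime to \<open>q ^ n\<close> and cancels.\<close>

lemma ideal2_E_power:
  assumes "q > 0" "coprime q m" "nu m q dvd T" "n > 0"
  shows "ideal2 P (of_nat (q ^ n)) (E * (1 - (1 + x) ^ T) ^ n)"
proof -
  define D where "D = 1 - (1 + x) ^ T"
  have "ideal2 P (of_nat q) (- 1 * (E * ((1 + x) ^ T - 1)))"
    by (intro ideal2_mult_left ideal2_E_nu assms)
  then have ED: "ideal2 P (of_nat q) (E * D)" by (simp add: D_def algebra_simps)
  have "P dvd E ^ Suc k - of_nat (m ^ k) * E" for k
  proof (induction k)
    case (Suc k)
    have "E ^ Suc (Suc k) - of_nat (m ^ Suc k) * E
        = E * (E ^ Suc k - of_nat (m ^ k) * E) + of_nat (m ^ k) * (E * E - of_nat m * E)"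
      by (simp add: algebra_simps)
    then show ?case using Suc P_dvd_E_square by (simp add: dvd_add)
  qed simp
  then have "P dvd E ^ n - of_nat (m ^ (n - 1)) * E"
    using assms(4) by (metis Suc_pred')
  then have "ideal2 P (of_nat (q ^ n)) ((E * D) ^ n - (E ^ n - of_nat (m ^ (n - 1)) * E) * D ^ n)"
    using ideal2_diff[OF ideal2_power[OF ED] ideal2_mult_right[OF ideal2_dvd_left]] by simp
  also have "(E * D) ^ n - (E ^ n - of_nat (m ^ (n - 1)) * E) * D ^ n
      = of_nat (m ^ (n - 1)) * (E * D ^ n)"
    by (simp add: power_mult_distrib algebra_simps)
  finally show ?thesis
    unfolding D_def by (rule ideal2_cancel) (use assms(2) in \<open>simp add: coprime_commute\<close>)
qed

lemma ideal2_one_plus_x: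
  assumes "q > 0" "coprime q m" "nu m q dvd T" "n > 0"
  shows "ideal2 P (of_nat (q ^ n)) (of_nat m * ((1 + x) ^ l * (1 - (1 + x) ^ T) ^ n)
           - (1 + eps) ^ l * (1 - (1 + eps) ^ T) ^ n * N)"
proof -
  define D D' where "D = 1 - (1 + x) ^ T" and "D' = 1 - (1 + eps) ^ T"
  have D1: "P dvd D * N - D' * N"
  proof -
    have "D * N - D' * N = - ((1 + x) ^ T * N - (1 + eps) ^ T * N)"
      by (simp add: D_def D'_def algebra_simps)
    then show ?thesis using P_dvd_power_N[of T] by (simp only: dvd_minus_iff)
  qed
  have D2: "P dvd D ^ k * N - D' ^ k * N" for k
  proof (induction k)
    case (Suc k)
    have "D ^ Suc k * N - D' ^ Suc k * N = D * (D ^ k * N - D' ^ k * N) + D' ^ k * (D * N - D' * N)"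
      by (simp add: algebra_simps)
    then show ?case using Suc D1 by (simp add: dvd_add)
  qed simp
  \<comment> \<open>With \<open>m = E + N\<close>, the \<open>E\<close> part vanishes, and in the
    \<open>N\<close> part \<open>x\<close> is replaced by \<open>eps\<close>, first in
    \<open>D ^ n\<close> and then in \<open>(1 + x) ^ l\<close>.\<close>
  have "ideal2 P (of_nat (q ^ n)) ((1 + x) ^ l * (E * D ^ n)
      + ((1 + x) ^ l * (D ^ n * N - D' ^ n * N) + D' ^ n * ((1 + x) ^ l * N - (1 + eps) ^ l * N)))"
    unfolding D_def[symmetric]
    by (intro ideal2_add ideal2_mult_left[OF ideal2_dvd_left[OF D2]]
        ideal2_mult_left[OF ideal2_dvd_left[OF P_dvd_power_N]]
        ideal2_mult_left[OF ideal2_E_power[OF assms, folded D_def]])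
  also have "(1 + x) ^ l * (E * D ^ n)
      + ((1 + x) ^ l * (D ^ n * N - D' ^ n * N) + D' ^ n * ((1 + x) ^ l * N - (1 + eps) ^ l * N))
      = of_nat m * ((1 + x) ^ l * D ^ n) - (1 + eps) ^ l * D' ^ n * N"
    by (simp add: E_def algebra_simps)
  finally show ?thesis by (simp add: D_def D'_def)
qed

end

section \<open>Coefficient sums over a residue class\<close>

text \<open>The coefficient at \<open>x ^ r\<close> in the quotient by \<open>x ^ m - 1\<close>,
  computed on a representing polynomial.\<close>

definition residue_coeff_sum :: "nat \<Rightarrow> int \<Rightarrow> int poly \<Rightarrow> int" where
  "residue_coeff_sum m r f = (\<Sum>k | k \<le> degree f \<and> [int k = r] (mod int m). coeff f k)"

lemma residue_coeff_sum_bound: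
  assumes "degree f \<le> B"
  shows "residue_coeff_sum m r f = (\<Sum>k | k \<le> B \<and> [int k = r] (mod int m). coeff f k)"
  unfolding residue_coeff_sum_def
  by (rule sum.mono_neutral_left) (use assms in \<open>auto intro: le_degree\<close>)

lemma residue_coeff_sum_add:
  "residue_coeff_sum m r (f + g) = residue_coeff_sum m r f + residue_coeff_sum m r g"
  by (simp add: residue_coeff_sum_bound[where B = "max (degree f) (degree g)"]
      degree_add_le sum.distrib)

lemma residue_coeff_sum_smult:
  "residue_coeff_sum m r (smult c f) = c * residue_coeff_sum m r f"
  by (simp add: residue_coeff_sum_bound[where B = "degree f"] degree_smult_le sum_distrib_left)

lemma residue_coeff_sum_0 [simp]: "residue_coeff_sum m r 0 = 0"
  by (simp add: residue_coeff_sum_def)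

lemma residue_coeff_sum_diff:
  "residue_coeff_sum m r (f - g) = residue_coeff_sum m r f - residue_coeff_sum m r g"
  using residue_coeff_sum_add[of m r "f - g" g] by simp

lemma residue_coeff_sum_sum:
  "residue_coeff_sum m r (\<Sum>i\<in>A. f i) = (\<Sum>i\<in>A. residue_coeff_sum m r (f i))"
  by (induction A rule: infinite_finite_induct) (simp_all add: residue_coeff_sum_add)

lemma residue_coeff_sum_monom:
  "residue_coeff_sum m r (monom c k) = (if [int k = r] (mod int m) then c else 0)"
proof -
  have "residue_coeff_sum m r (monom c k)
      = (\<Sum>i | i \<le> k \<and> [int i = r] (mod int m). if i = k then c else 0)"
    by (subst residue_coeff_sum_bound[OF degree_monom_le]) (auto intro!: sum.cong)
  then show ?thesis by (simp add: sum.delta)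
qed

text \<open>Multiplication by \<open>x ^ m\<close> shifts every exponent within its residue class.
  Hence the functional depends only on the class of the polynomial in the quotient.\<close>

lemma residue_coeff_sum_cyclic: "residue_coeff_sum m r ((monom 1 m - 1) * u) = 0"
proof -
  have "(monom 1 m - 1) * u = (\<Sum>i\<le>degree u. (monom 1 m - 1) * monom (coeff u i) i)"
    by (simp add: poly_as_sum_of_monoms flip: sum_distrib_left)
  then show ?thesis
    by (simp add: residue_coeff_sum_sum left_diff_distrib residue_coeff_sum_diff mult_monom
        residue_coeff_sum_monom cong_def)
qed

lemma residue_coeff_sum_binomial:
  "residue_coeff_sum m r ((1 + monom 1 1) ^ K) = int (binom_residue_sum m K r)"
proof -
  have "(1 + monom 1 1) ^ K = (\<Sum>k\<le>K. monom (int (K choose k)) k)"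
    using binomial_ring[of "monom 1 1" "1 :: int poly" K]
    by (simp add: add.commute monom_power of_nat_monom mult_monom)
  then have "residue_coeff_sum m r ((1 + monom 1 1) ^ K)
      = (\<Sum>k\<le>K. if [int k = r] (mod int m) then int (K choose k) else 0)"
    by (simp add: residue_coeff_sum_sum residue_coeff_sum_monom)
  also have "\<dots> = (\<Sum>k\<in>{k\<in>{..K}. [int k = r] (mod int m)}. int (K choose k))"
    by (rule sum.inter_filter[symmetric]) simp
  finally show ?thesis by (simp add: binom_residue_sum_def)
qed

text \<open>Exactly one exponent below \<open>m\<close> lies in the class of \<open>r\<close>. This
  evaluates the functional on \<open>N\<close>.\<close>

lemma residue_coeff_sum_geometric:
  assumes "m > 0"
  shows "residue_coeff_sum m r (\<Sum>i<m. monom (c ^ i) i) = c ^ nat (r mod int m)"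
proof -
  have "[int i = r] (mod int m) \<longleftrightarrow> i = nat (r mod int m)" if "i < m" for i
    using that by (auto simp: cong_def)
  then have "residue_coeff_sum m r (\<Sum>i<m. monom (c ^ i) i)
      = (\<Sum>i<m. if i = nat (r mod int m) then c ^ i else 0)"
    by (simp add: residue_coeff_sum_sum residue_coeff_sum_monom)
  moreover have "nat (r mod int m) < m" using assms by (simp add: nat_less_iff)
  ultimately show ?thesis by (simp add: sum.delta)
qed

section \<open>Reading off the integer congruence\<close>

theorem theorem1p1:
  fixes q m T l n :: nat and r :: int
  assumes "q > 1" and "m > 0" and "coprime q m"
    and "T > 0" and "nu m q dvd T"
    and "n > 0"
  shows "[(\<Sum>k=0..n. (- 1) ^ k * int (n choose k) * int (binom_residue_sum m (k * T + l) r)) =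
          (if odd m
           then 2 ^ l * (1 - 2 ^ T) ^ n * modular_inverse (int q ^ n) (int m)
           else (if l = 0 then 1 else 0) * (- 1) ^ nat \<bar>r\<bar> * modular_inverse (int q ^ n) (int m))]
         (mod int q ^ n)"
proof -
  define x where "x = (monom 1 1 :: int poly)"
  interpret cyclic_relation x m .
  define S where
    "S = (\<Sum>k=0..n. (- 1) ^ k * int (n choose k) * int (binom_residue_sum m (k * T + l) r))"
  define e where "e = (if odd m then 1 else - 1 :: int)"
  define \<phi> where "\<phi> = residue_coeff_sum m r"
  \<comment> \<open>The value of \<open>(1 + x) ^ l * (1 - (1 + x) ^ T) ^ n\<close> at
    \<open>x = e\<close>.\<close>
  define R where "R = (1 + e) ^ l * (1 - (1 + e) ^ T) ^ n"
  have eps: "eps = [:e:]" by (simp add: eps_def e_def one_pCons)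
  have P: "P = monom 1 m - 1" unfolding P_def by (simp add: x_def monom_power)
  have "N = (\<Sum>i<m. monom (e ^ i) i)"
    unfolding N_def eps by (simp add: x_def smult_monom monom_power power_mult_distrib)
  then have \<phi>N: "\<phi> N = e ^ nat (r mod int m)"
    unfolding \<phi>_def using assms(2) by (simp add: residue_coeff_sum_geometric)
  have "(1 + x) ^ l * (1 - (1 + x) ^ T) ^ n
      = (\<Sum>k\<le>n. smult ((- 1) ^ k * int (n choose k)) ((1 + x) ^ (k * T + l)))"
  proof -
    have "(1 - (1 + x) ^ T) ^ n
        = (\<Sum>k\<le>n. of_nat (n choose k) * (- ((1 + x) ^ T)) ^ k * 1 ^ (n - k))"
      by (subst binomial_ring[symmetric]) simp
    also have "\<dots> = (\<Sum>k\<le>n. smult ((- 1) ^ k * int (n choose k)) ((1 + x) ^ (k * T)))"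
    proof (rule sum.cong[OF refl])
      fix k
      have "(- ((1 + x) ^ T)) ^ k = smult ((- 1) ^ k) ((1 + x) ^ (k * T))"
        by (cases "even k") (simp_all flip: power_mult add: mult.commute)
      then show "of_nat (n choose k) * (- ((1 + x) ^ T)) ^ k * 1 ^ (n - k)
          = smult ((- 1) ^ k * int (n choose k)) ((1 + x) ^ (k * T))"
        by (simp add: of_nat_poly mult.commute)
    qed
    finally show ?thesis by (simp add: sum_distrib_left power_add mult.commute)
  qed
  then have \<phi>S: "\<phi> ((1 + x) ^ l * (1 - (1 + x) ^ T) ^ n) = S"
    unfolding \<phi>_def S_def x_def
    by (simp add: residue_coeff_sum_sum residue_coeff_sum_smult residue_coeff_sum_binomial
        atLeast0AtMost del: One_nat_def)
  have "ideal2 P (of_nat (q ^ n)) (of_nat m * ((1 + x) ^ l * (1 - (1 + x) ^ T) ^ n)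
      - (1 + eps) ^ l * (1 - (1 + eps) ^ T) ^ n * N)"
    using assms by (intro ideal2_one_plus_x) auto
  moreover have "(1 + eps) ^ l * (1 - (1 + eps) ^ T) ^ n = [:R:]"
    by (simp add: R_def eps one_pCons poly_const_pow)
  ultimately obtain u v where
    "smult (int m) ((1 + x) ^ l * (1 - (1 + x) ^ T) ^ n) - smult R N
      = P * u + smult (int q ^ n) v"
    unfolding ideal2_def by (auto simp: of_nat_poly poly_const_pow)
  \<comment> \<open>Applying the functional kills the multiple of \<open>P\<close> and turns the
    polynomial relation into one between integers.\<close>
  then have "\<phi> (smult (int m) ((1 + x) ^ l * (1 - (1 + x) ^ T) ^ n) - smult R N)
      = \<phi> (P * u + smult (int q ^ n) v)" by simp
  then have "int m * S - R * \<phi> N = int q ^ n * \<phi> v"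
    using \<phi>S unfolding \<phi>_def P
    by (simp add: residue_coeff_sum_diff residue_coeff_sum_add residue_coeff_sum_smult
        residue_coeff_sum_cyclic)
  then have mS: "[int m * S = R * \<phi> N] (mod int q ^ n)"
    by (simp add: cong_iff_dvd_diff)
  have RHS: "R * \<phi> N = (if odd m then 2 ^ l * (1 - 2 ^ T) ^ n
      else (if l = 0 then 1 else 0) * (- 1) ^ nat \<bar>r\<bar>)"
  proof (cases "odd m")
    case True
    then show ?thesis by (simp add: R_def e_def \<phi>N)
  next
    case False
    \<comment> \<open>Reduction modulo an even \<open>m\<close> preserves the parity of
      \<open>r\<close>, as does taking the absolute value.\<close>
    have "even (nat (r mod int m)) \<longleftrightarrow> even (nat \<bar>r\<bar>)"
      using False assms(2) by (simp add: even_nat_iff dvd_mod_iff)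
    then have "(- 1 :: int) ^ nat (r mod int m) = (- 1) ^ nat \<bar>r\<bar>"
      by (simp add: minus_one_power_iff)
    \<comment> \<open>Here \<open>1 + e = 0\<close>: positivity of \<open>T\<close> makes the second
      factor of \<open>R\<close> equal to 1, and \<open>0 ^ l\<close> is the Kronecker
      delta.\<close>
    then show ?thesis using False assms(4) by (simp add: R_def e_def \<phi>N power_0_left)
  qed
  define M where "M = modular_inverse (int q ^ n) (int m)"
  have "[M * int m = 1] (mod int q ^ n)"
    unfolding M_def using assms(3) by (intro cong_modular_inverse2) (simp add: coprime_commute)
  then have "[M * int m * S = 1 * S] (mod int q ^ n)" by (intro cong_mult cong_refl)
  moreover have "[M * (int m * S) = M * (R * \<phi> N)] (mod int q ^ n)"
    by (intro cong_mult cong_refl mS)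
  ultimately have "[S = R * \<phi> N * M] (mod int q ^ n)"
    by (simp add: mult_ac) (metis cong_sym cong_trans)
  then show ?thesis
    unfolding RHS S_def M_def by (cases "even m") (simp_all only: simp_thms if_True if_False)
qed

end
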